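(* Let $\Delta^{(1)},\Delta^{(2)}\in\mathbb{C}^{n\times n}$ be two nonderogatory upper triangular matrices with identical sets of eigenvalues (with multiplicity), identically ordered on the diagonals, i.e. $\Delta^{(1)}_{ii}=\Delta^{(2)}_{ii}$ for $i=1,\ldots,n$. Let $$\mathbb{I}=\Bigl\{k=(k_{ij})_{1\le i<j\le n}\in\mathbb{Z}^{n(n-1)/2}:\ k_{ij}\in\{0,1,-1\}\ \text{for } 1\le i<j\le n-1,\quad k_{in}=0\ \text{for } 1\le i\le n-1\Bigr\}.$$ Then $\Delta^{(1)}$ and $\Delta^{(2)}$ are unitarily similar if and only if there exist vectors $k^{(1)},k^{(2)}\in\mathbb{I}$ such that $$\mathcal{K}(\Delta^{(1)},k^{(1)})=\mathcal{K}(\Delta^{(2)},k^{(2)}),$$ where $\mathcal{K}(\Delta,m)$ is the matrix defined in the context.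
   Context: A matrix in $\mathbb{C}^{n\times n}$ is nonderogatory if distinct Jordan blocks have distinct eigenvalues (equivalently, its characteristic and minimal polynomials coincide). Matrices $A,B$ are unitarily similar if $B=UAU^*$ for some unitary $U$. For real $r=(r_{ij})_{1\le i<j\le n}$ and $\varphi=(\varphi_{ij})_{1\le i<j\le n}$, let $R(r)$ be the symmetric $(n-1)\times(n-1)$ matrix with entries $$\{R(r)\}_{ij}=\begin{cases}-r_{ij}, & i<j,\\ \sum_{k=1}^{i-1}r_{ki}+\sum_{k=i+1}^{n}r_{ik}, & i=j,\\ -r_{ji}, & i>j,\end{cases}$$ and let $b(r,\varphi)\in\mathbb{R}^{n-1}$ be the vector with components $$b_s(r,\varphi)=-\sum_{k=1}^{s-1}r_{ks}\varphi_{ks}+\sum_{k=s+1}^{n}r_{sk}\varphi_{sk},\qquad s=1,\ldots,n-1.$$ Definition of $\mathcal{K}(\Delta,m)$: let $\Delta\in\mathbb{C}^{n\times n}$ be upper triangular and $m=(m_{ij})_{1\le i<j\le n}\in\mathbb{Z}^{n(n-1)/2}$. Put $r_{ij}=|\Delta_{ij}|$ and $\varphi_{ij}=\arg\Delta_{ij}-\pi$ for $1\le i<j\le n$, where $\arg$ takes values in $[0,2\pi)$, so that $\varphi_{ij}\in[-\pi,\pi)$ (when $\Delta_{ij}=0$ the value of $\varphi_{ij}$ is irrelevant, since it enters only through $r_{ij}\varphi_{ij}$). Let $\psi=(\psi_1,\ldots,\psi_{n-1})\in\mathbb{R}^{n-1}$ be a solution of the linear system $$R(r)\,\psi=-b(r,\varphi+2\pi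 m),$$ and set $\mathcal{K}(\Delta,m)=X\Delta X^*$ with $X=\mathrm{diag}(e^{\mathrm{i}\psi_1},\ldots,e^{\mathrm{i}\psi_{n-1}},1)$, where $\mathrm{i}$ is the imaginary unit. The system always has a solution, and the matrix $X\Delta X^*$ does not depend on which solution $\psi$ is chosen, so $\mathcal{K}(\Delta,m)$ is well defined. *)

theory Defs
  imports
    "Jordan_Normal_Form.Jordan_Normal_Form"
    "Jordan_Normal_Form.Schur_Decomposition"
    "HOL-Analysis.Complex_Transcendental"
begin

(* Indices are 0-based, as usual for the matrices of Jordan_Normal_Form: the pairs 1 <= i < j <= n
   of the mathematical text are i < j < n here, and its index n is n - 1.
   Families indexed by the pairs i < j are functions of two arguments; only their values
   at i < j < n are ever used. *)

definition nonderogatory :: "complex mat \<Rightarrow> bool" where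
  "nonderogatory A \<longleftrightarrow> (\<exists>n_as. jordan_nf A n_as \<and> distinct (map snd n_as))"

definition unitary_mat :: "nat \<Rightarrow> complex mat \<Rightarrow> bool" where
  "unitary_mat n U \<longleftrightarrow>
     U \<in> carrier_mat n n \<and> U * mat_adjoint U = 1\<^sub>m n \<and> mat_adjoint U * U = 1\<^sub>m n"

definition unitarily_similar :: "complex mat \<Rightarrow> complex mat \<Rightarrow> bool" where
  "unitarily_similar A B \<longleftrightarrow>
     (\<exists>n U. A \<in> carrier_mat n n \<and> B \<in> carrier_mat n n \<and> unitary_mat n U \<and>
        B = U * A * mat_adjoint U)"

definition R_mat :: "nat \<Rightarrow> (nat \<Rightarrow> nat \<Rightarrow> real) \<Rightarrow> real mat" where
  "R_mat n r = Matrix.mat (n - 1) (n - 1) (\<lambda>(i, j).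
     if i < j then - r i j
     else if i = j then (\<Sum>k\<in>{0..<i}. r k i) + (\<Sum>k\<in>{i<..<n}. r i k)
     else - r j i)"

definition b_vec :: "nat \<Rightarrow> (nat \<Rightarrow> nat \<Rightarrow> real) \<Rightarrow> (nat \<Rightarrow> nat \<Rightarrow> real) \<Rightarrow> real Matrix.vec" where
  "b_vec n r \<phi> = Matrix.vec (n - 1) (\<lambda>s.
     - (\<Sum>k\<in>{0..<s}. r k s * \<phi> k s) + (\<Sum>k\<in>{s<..<n}. r s k * \<phi> s k))"

definition mod_entries :: "complex mat \<Rightarrow> nat \<Rightarrow> nat \<Rightarrow> real" where
  "mod_entries \<Delta> i j = cmod (\<Delta> $$ (i, j))"

(* Arg2pi takes values in [0, 2 pi). *)
definition arg_entries :: "complex mat \<Rightarrow> nat \<Rightarrow> nat \<Rightarrow> real" where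
  "arg_entries \<Delta> i j = Arg2pi (\<Delta> $$ (i, j)) - pi"

definition is_K_solution :: "complex mat \<Rightarrow> (nat \<Rightarrow> nat \<Rightarrow> int) \<Rightarrow> real Matrix.vec \<Rightarrow> bool" where
  "is_K_solution \<Delta> m \<psi> \<longleftrightarrow>
     (let n = dim_row \<Delta>; r = mod_entries \<Delta>; \<phi> = arg_entries \<Delta> in
        \<psi> \<in> carrier_vec (n - 1) \<and>
        R_mat n r *\<^sub>v \<psi> = - b_vec n r (\<lambda>i j. \<phi> i j + 2 * pi * real_of_int (m i j)))"

definition X_mat :: "nat \<Rightarrow> real Matrix.vec \<Rightarrow> complex mat" where
  "X_mat n \<psi> = mat_diag n (\<lambda>i. if i < n - 1 then exp (\<i> * complex_of_real (vec_index \<psi> i)) else 1)"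

(* For upper triangular \<Delta> the system always has a solution, and X \<Delta> X^* is the same for all
   of its solutions, so the choice made by SOME is immaterial. *)
definition K_mat :: "complex mat \<Rightarrow> (nat \<Rightarrow> nat \<Rightarrow> int) \<Rightarrow> complex mat" where
  "K_mat \<Delta> m =
     (let X = X_mat (dim_row \<Delta>) (SOME \<psi>. is_K_solution \<Delta> m \<psi>)
      in X * \<Delta> * mat_adjoint X)"

definition I_set :: "nat \<Rightarrow> (nat \<Rightarrow> nat \<Rightarrow> int) set" where
  "I_set n = {k. (\<forall>i j. i < j \<and> j < n - 1 \<longrightarrow> k i j \<in> {0, 1, -1}) \<and>
                 (\<forall>i < n - 1. k i (n - 1) = 0)}"

end

(* A unitary U with U A = B U, where A and B are upper triangular with equal diagonals and B is
   nonderogatory, is diagonal. Indeed, once columns and rows before k of U are known to be diagonal,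
   column k is an eigenvector of a trailing block of B; the eigenspace is spanned by the basis vector
   of index k, and unitarity clears the rest of row k.

   Hence unitary similarity amounts to shifting the arguments phi_ij of the entries by
   theta_i - theta_j, up to multiples 2 pi N_ij of a full turn. The linear system defining K is the
   grounded Laplacian system of the network with weights r_ij: it is the normal equation of a weighted
   least squares problem, so it is solvable, with potential differences unique across every edge with
   r_ij > 0. Its right-hand side absorbs the theta, so K is the same for both matrices as soon as the
   integer vectors differ by N. The theta can be chosen with N_ij = 0 in the last column and
   |theta_i| < 2 pi, so |N_ij| < 3 and N is a difference of two elements of I. *)
theory Submission
  imports Defs "Jordan_Normal_Form.Jordan_Normal_Form_Uniqueness"
begin

section \<open>Grounded network equations\<close>

definition edge_sum :: "nat \<Rightarrow> (nat \<Rightarrow> nat \<Rightarrow> real) \<Rightarrow> real" where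
  "edge_sum n g = (\<Sum>j<n. \<Sum>i<j. g i j)"

text \<open>A discrete divergence: every edge is oriented from its smaller to its larger endpoint,
  so this is outflow minus inflow at \<open>s\<close>, with the signs of
  \<open>b_vec\<close>.\<close>

definition net_flow :: "nat \<Rightarrow> (nat \<Rightarrow> nat \<Rightarrow> real) \<Rightarrow> nat \<Rightarrow> real" where
  "net_flow n g s = (\<Sum>k\<in>{s<..<n}. g s k) - (\<Sum>k<s. g k s)"

text \<open>Summation by parts: every edge occurs at both of its endpoints, with opposite signs.
  Divergence is thus adjoint to taking potential differences.\<close>

lemma sum_net_flow:
  "(\<Sum>s<n. h s * net_flow n g s) = edge_sum n (\<lambda>i j. g i j * (h i - h j))"
proof -
  have "(\<Sum>s<n. \<Sum>k\<in>{s<..<n}. h s * g s k) = (\<Sum>j<n. \<Sum>i<j. h i * g i j)"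
    unfolding sum.Sigma[OF finite_lessThan, simplified]
    by (simp add: sum.Sigma)
      (rule sum.reindex_bij_witness[of _ "\<lambda>(j, i). (i, j)" "\<lambda>(i, j). (j, i)"], auto)
  then show ?thesis
    unfolding net_flow_def edge_sum_def
    by (simp add: algebra_simps sum_distrib_left sum_subtractf)
qed

lemma net_flow_diff: "net_flow n (\<lambda>i j. g i j - h i j) s = net_flow n g s - net_flow n h s"
  unfolding net_flow_def by (simp add: sum_subtractf)

lemma net_flow_add: "net_flow n (\<lambda>i j. g i j + h i j) s = net_flow n g s + net_flow n h s"
  unfolding net_flow_def by (simp add: sum.distrib)

lemma net_flow_cong:
  assumes "\<And>i j. i < j \<Longrightarrow> j < n \<Longrightarrow> g i j = h i j" "s < n"
  shows "net_flow n g s = net_flow n h s"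
proof -
  have "(\<Sum>k\<in>{s<..<n}. g s k) = (\<Sum>k\<in>{s<..<n}. h s k)" "(\<Sum>k<s. g k s) = (\<Sum>k<s. h k s)"
    using assms by (auto intro!: sum.cong)
  then show ?thesis unfolding net_flow_def by simp
qed

text \<open>Weights may vanish and the \<open>v i\<close> may be dependent, so the Gram matrix can
  be singular. Gram-Schmidt avoids inverting it. The induction keeps \<open>y\<close> arbitrary
  because the hypothesis is applied both to \<open>y\<close> and to the new vector
  \<open>v m\<close>.\<close>

lemma weighted_least_squares:
  fixes r y :: "'e \<Rightarrow> real" and v :: "nat \<Rightarrow> 'e \<Rightarrow> real"
  assumes fin: "finite E" and r: "\<And>e. e \<in> E \<Longrightarrow> 0 \<le> r e"
  shows "\<exists>c. \<forall>j<m. (\<Sum>e\<in>E. r e * (y e - (\<Sum>i<m. c i * v i e)) * v j e) = 0"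
proof (induction m arbitrary: y)
  case 0
  then show ?case by simp
next
  case (Suc m)
  obtain a where a: "\<And>j. j < m \<Longrightarrow> (\<Sum>e\<in>E. r e * (v m e - (\<Sum>i<m. a i * v i e)) * v j e) = 0"
    using Suc[of "v m"] by blast
  obtain c where c: "\<And>j. j < m \<Longrightarrow> (\<Sum>e\<in>E. r e * (y e - (\<Sum>i<m. c i * v i e)) * v j e) = 0"
    using Suc[of y] by blast
  define w where "w e = v m e - (\<Sum>i<m. a i * v i e)" for e
  define z where "z e = y e - (\<Sum>i<m. c i * v i e)" for e
  \<comment> \<open>If w has weighted norm 0, then t = 0 by the convention for division, and z is already orthogonal to w.\<close>
  define t where "t = (\<Sum>e\<in>E. r e * z e * w e) / (\<Sum>e\<in>E. r e * w e * w e)"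
  \<comment> \<open>Adding \<open>t\<close> times \<open>w\<close> to the old projection of
    \<open>y\<close> and expanding \<open>w\<close> in the \<open>v i\<close> gives these
    coefficients.\<close>
  define d where "d i = (if i = m then t else c i - t * a i)" for i
  have res: "y e - (\<Sum>i<Suc m. d i * v i e) = z e - t * w e" for e
    by (simp add: d_def z_def w_def algebra_simps sum_subtractf sum_distrib_left)
  have old: "(\<Sum>e\<in>E. r e * (z e - t * w e) * v j e) = 0" if "j < m" for j
  proof -
    have "(\<Sum>e\<in>E. r e * (z e - t * w e) * v j e)
        = (\<Sum>e\<in>E. r e * z e * v j e) - t * (\<Sum>e\<in>E. r e * w e * v j e)"
      by (simp add: algebra_simps sum_subtractf sum_distrib_left)
    then show ?thesis using a[OF that] c[OF that] by (simp add: z_def w_def)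
  qed
  have new: "(\<Sum>e\<in>E. r e * (z e - t * w e) * w e) = 0"
  proof -
    have eq: "(\<Sum>e\<in>E. r e * (z e - t * w e) * w e)
        = (\<Sum>e\<in>E. r e * z e * w e) - t * (\<Sum>e\<in>E. r e * w e * w e)"
      by (simp add: algebra_simps sum_subtractf sum_distrib_left)
    show ?thesis
    proof (cases "(\<Sum>e\<in>E. r e * w e * w e) = 0")
      case True
      have nonneg: "0 \<le> r e * w e * w e" if "e \<in> E" for e
        using mult_nonneg_nonneg[OF r[OF that] zero_le_square[of "w e"]] by (simp add: mult.assoc)
      have "r e * w e = 0" if "e \<in> E" for e
        using True sum_nonneg_eq_0_iff[OF fin nonneg] that by auto
      then have "(\<Sum>e\<in>E. r e * z e * w e) = 0"
        by (intro sum.neutral) auto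
      then show ?thesis using eq True by simp
    next
      case False
      then show ?thesis unfolding eq by (simp add: t_def)
    qed
  qed
  \<comment> \<open>Since \<open>v m\<close> is \<open>w\<close> plus a combination of the earlier
    vectors, orthogonality to these suffices.\<close>
  have "(\<Sum>e\<in>E. r e * (z e - t * w e) * v m e)
      = (\<Sum>e\<in>E. r e * (z e - t * w e) * w e)
        + (\<Sum>i<m. a i * (\<Sum>e\<in>E. r e * (z e - t * w e) * v i e))"
  proof -
    have "(\<Sum>i<m. a i * (\<Sum>e\<in>E. r e * (z e - t * w e) * v i e))
        = (\<Sum>e\<in>E. r e * (z e - t * w e) * (\<Sum>i<m. a i * v i e))"
      by (simp add: sum_distrib_left sum.swap[of _ E] ac_simps)
    then show ?thesis
      by (simp add: w_def algebra_simps flip: sum.distrib)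
  qed
  also have "\<dots> = 0" using new old by simp
  finally have top: "(\<Sum>e\<in>E. r e * (z e - t * w e) * v m e) = 0" .
  have "(\<Sum>e\<in>E. r e * (y e - (\<Sum>i<Suc m. d i * v i e)) * v j e) = 0" if "j < Suc m" for j
    using that old[of j] top unfolding res by (cases "j = m") auto
  then show ?case by blast
qed

text \<open>These are the normal equations for approximating \<open>\<phi>\<close> by potential
  differences. The admissible directions are the indicators of the nodes other than the ground
  \<open>n - 1\<close>.\<close>

lemma net_flow_solvable:
  fixes r \<phi> :: "nat \<Rightarrow> nat \<Rightarrow> real"
  assumes r: "\<And>i j. 0 \<le> r i j"
  shows "\<exists>p. p (n - 1) = 0 \<and>
    (\<forall>s<n - 1. net_flow n (\<lambda>i j. r i j * (p i - p j + \<phi> i j)) s = 0)"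
proof -
  define E where "E = (SIGMA j:{..<n}. {..<j})"
  have E: "edge_sum n g = (\<Sum>(j, i)\<in>E. g i j)" for g
    unfolding edge_sum_def E_def by (simp add: sum.Sigma)
  define h where "h s i = (of_bool (i = s) :: real)" for s i :: nat
  obtain c where c: "\<And>s. s < n - 1 \<Longrightarrow> (\<Sum>e\<in>E. r (snd e) (fst e) *
      (\<phi> (snd e) (fst e) - (\<Sum>i<n - 1. c i * (h i (snd e) - h i (fst e)))) *
      (h s (snd e) - h s (fst e))) = 0"
    using weighted_least_squares[of E "\<lambda>e. r (snd e) (fst e)" "n - 1" "\<lambda>e. \<phi> (snd e) (fst e)"
        "\<lambda>s e. h s (snd e) - h s (fst e)"] r
    by (auto simp: E_def)
  \<comment> \<open>The sign changes because least squares subtracts the fitted differences, whereas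
    the flow adds them.\<close>
  define p where "p i = (if i < n - 1 then - c i else 0)" for i
  have p: "(\<Sum>i<n - 1. c i * (h i k - h i l)) = p l - p k" for k l
  proof -
    have "(\<Sum>i<n - 1. c i * h i k) = - p k" for k
      by (simp add: p_def h_def of_bool_def if_distrib cong: if_cong)
    then show ?thesis by (simp add: right_diff_distrib sum_subtractf del: One_nat_def)
  qed
  have "net_flow n (\<lambda>i j. r i j * (p i - p j + \<phi> i j)) s = 0" if s: "s < n - 1" for s
  proof -
    let ?g = "\<lambda>i j. r i j * (p i - p j + \<phi> i j)"
    \<comment> \<open>Testing against the indicator of \<open>s\<close> turns the equation at one
      node into an orthogonality relation over the edges.\<close>
    have "net_flow n ?g s = (\<Sum>i<n. h s i * net_flow n ?g i)"
      using s by (simp add: h_def of_bool_def mult_delta_left)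
    also have "\<dots> = (\<Sum>(j, i)\<in>E. ?g i j * (h s i - h s j))"
      by (simp add: sum_net_flow E)
    also have "\<dots> = 0"
      using c[OF s] unfolding p by (simp add: case_prod_unfold algebra_simps)
    finally show ?thesis .
  qed
  then show ?thesis by (intro exI[of _ p]) (simp add: p_def)
qed

text \<open>The difference of two solutions has zero Dirichlet energy. Edges of weight 0 carry no
  energy and may disconnect the network, so only differences across the other edges are
  determined.\<close>

lemma net_flow_unique:
  fixes r \<phi> :: "nat \<Rightarrow> nat \<Rightarrow> real"
  assumes r: "\<And>i j. 0 \<le> r i j" and last: "p (n - 1) = q (n - 1)"
    and p: "\<And>s. s < n - 1 \<Longrightarrow> net_flow n (\<lambda>i j. r i j * (p i - p j + \<phi> i j)) s = 0"
    and q: "\<And>s. s < n - 1 \<Longrightarrow> net_flow n (\<lambda>i j. r i j * (q i - q j + \<phi> i j)) s = 0"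
    and ij: "i < j" "j < n" "r i j \<noteq> 0"
  shows "p i - p j = q i - q j"
proof -
  define d where "d k = p k - q k" for k
  let ?g = "\<lambda>i j. r i j * (d i - d j)"
  have "net_flow n ?g s = 0" if "s < n - 1" for s
  proof -
    have "?g = (\<lambda>i j. r i j * (p i - p j + \<phi> i j) - r i j * (q i - q j + \<phi> i j))"
      by (auto simp: d_def algebra_simps)
    then show ?thesis using p[OF that] q[OF that] by (simp add: net_flow_diff)
  qed
  moreover have "d (n - 1) = 0" using last by (simp add: d_def)
  \<comment> \<open>There is no equation at the ground, but there the factor \<open>d\<close>
    vanishes.\<close>
  ultimately have "d s * net_flow n ?g s = 0" if "s < n" for s
    using that by (cases "s = n - 1") auto
  then have "0 = (\<Sum>s<n. d s * net_flow n ?g s)" by (intro sum.neutral[symmetric]) auto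
  also have "\<dots> = (\<Sum>j<n. \<Sum>i<j. r i j * (d i - d j)\<^sup>2)"
    by (simp add: sum_net_flow edge_sum_def power2_eq_square mult.assoc)
  finally have 0: "(\<Sum>j<n. \<Sum>i<j. r i j * (d i - d j)\<^sup>2) = 0" by simp
  have "\<forall>j<n. (\<Sum>i<j. r i j * (d i - d j)\<^sup>2) = 0"
    using 0 by (subst (asm) sum_nonneg_eq_0_iff) (auto intro!: sum_nonneg mult_nonneg_nonneg r)
  then have "(\<Sum>i<j. r i j * (d i - d j)\<^sup>2) = 0" using ij by blast
  then have "\<forall>i<j. r i j * (d i - d j)\<^sup>2 = 0"
    by (subst (asm) sum_nonneg_eq_0_iff) (auto intro!: mult_nonneg_nonneg r)
  then show ?thesis using ij by (auto simp: d_def)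
qed

section \<open>Unitary intertwiners of upper triangular matrices\<close>

text \<open>The dimension of the eigenspace is the number of Jordan blocks for \<open>l\<close>,
  which is at most one. Plain functions stand for vectors, so that trailing blocks can later be
  treated as index ranges.\<close>

lemma nonderogatory_eigenspace:
  assumes A: "A \<in> carrier_mat n n" and nd: "nonderogatory A"
  shows "\<exists>b. \<forall>v. (\<forall>i<n. (\<Sum>j<n. A $$ (i, j) * v j) = l * v i) \<longrightarrow> (\<exists>c. \<forall>i<n. v i = c * b i)"
proof -
  obtain n_as where jnf: "jordan_nf A n_as" and dist: "distinct (map snd n_as)"
    using nd unfolding nonderogatory_def by blast
  define C where "C = char_matrix A l"
  have C: "C \<in> carrier_mat n n" using A by (simp add: C_def)
  interpret K: kernel n n C by unfold_locales (rule C)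
  \<comment> \<open>This sum is the library's formula for the dimension of the kernel of
    \<open>char_matrix A l\<close>: each block for \<open>l\<close> contributes
    \<open>min 1 k\<close>.\<close>
  have "(\<Sum>k \<leftarrow> map fst [(k, e)\<leftarrow>xs . e = l]. min 1 k) \<le> 1"
    if "distinct (map snd xs)" for xs :: "(nat \<times> complex) list"
  proof -
    have "length [(k, e)\<leftarrow>xs . e = l] \<le> 1"
    proof -
      have "card (snd ` set [(k, e)\<leftarrow>xs . e = l]) \<le> card {l}"
        by (intro card_mono) auto
      moreover have "distinct (map snd [(k, e)\<leftarrow>xs . e = l])"
        using that by (rule distinct_map_filter)
      ultimately show ?thesis by (metis card.empty card_insert_disjoint distinct_card
            empty_iff finite.emptyI length_map One_nat_def list.set_map)
    qed
    moreover have "(\<Sum>k \<leftarrow> ys. min 1 k) \<le> length ys" for ys :: "nat list"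
      by (induction ys) auto
    ultimately show ?thesis by (metis length_map order_trans)
  qed
  then have "dim_gen_eigenspace A l 1 \<le> 1"
    using dim_gen_eigenspace[OF jnf, of l 1] dist by simp
  then have dim: "K.dim \<le> 1"
    using A by (simp add: dim_gen_eigenspace_def flip: C_def)
  obtain B where finB: "finite B" and basis: "K.basis B"
    using kernel_basis_exists[OF C] by blast
  have "card B \<le> 1" using dim K.Ker.dim_basis[OF finB basis] by simp
  \<comment> \<open>The basis is empty when \<open>l\<close> is not an eigenvalue, hence an
    inclusion rather than an equality.\<close>
  then obtain b where b: "B \<subseteq> {b}"
    using finB by (metis One_nat_def card_1_singletonE card_0_eq le_Suc_eq le_zero_eq
        subset_refl empty_subsetI)
  have "\<exists>c. \<forall>i<n. v i = c * b $ i" if v: "\<forall>i<n. (\<Sum>j<n. A $$ (i, j) * v j) = l * v i" for v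
  proof -
    have "Matrix.vec n v \<in> mat_kernel C"
    proof (rule mat_kernelI[OF C])
      show "C *\<^sub>v Matrix.vec n v = 0\<^sub>v n"
      proof (rule eq_vecI)
        fix i assume "i < dim_vec (0\<^sub>v n :: complex Matrix.vec)"
        then have i: "i < n" by simp
        have "(C *\<^sub>v Matrix.vec n v) $ i = (\<Sum>j<n. C $$ (i, j) * v j)"
          using i C by (auto simp: scalar_prod_def atLeast0LessThan intro!: sum.cong)
        also have "\<dots> = (\<Sum>j<n. A $$ (i, j) * v j - (if j = i then l * v j else 0))"
          using i A by (intro sum.cong) (auto simp: C_def char_matrix_def algebra_simps)
        also have "\<dots> = 0" using v i by (simp add: sum_subtractf)
        finally show "(C *\<^sub>v Matrix.vec n v) $ i = 0\<^sub>v n $ i" using i by simp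
      qed (use C in auto)
    qed simp
    moreover have Bsub: "B \<subseteq> mat_kernel C" and "K.span B = mat_kernel C"
      using basis unfolding K.Ker.basis_def by auto
    ultimately have "Matrix.vec n v \<in> K.span B" by simp
    then obtain a where a: "Matrix.vec n v = K.lincomb a B"
      unfolding K.Ker.finite_span[OF finB Bsub] by blast
    have "v i = (if b \<in> B then a b else 0) * b $ i" if "i < n" for i
    proof -
      have "v i = (\<Sum>x\<in>B. a x * x $ i)"
        using K.lincomb_index[OF that Bsub, of a] that by (simp flip: a)
      also have "B = (if b \<in> B then {b} else {})" using b by auto
      finally show ?thesis by (auto split: if_splits)
    qed
    then show ?thesis by blast
  qed
  then show ?thesis by blast
qed

text \<open>Leading indices are removed one at a time. A solution on the smaller block lifts to the
  larger one if an entry at \<open>k\<close> can be found that satisfies row \<open>k\<close>; the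
  lower rows do not see this entry, by triangularity.\<close>

lemma trailing_eigenspace:
  fixes A :: "complex mat"
  assumes A: "A \<in> carrier_mat n n" and ut: "upper_triangular A" and nd: "nonderogatory A"
    and "k \<le> n"
  shows "\<exists>b. \<forall>v. (\<forall>i\<in>{k..<n}. (\<Sum>j\<in>{k..<n}. A $$ (i, j) * v j) = l * v i)
    \<longrightarrow> (\<exists>c. \<forall>i\<in>{k..<n}. v i = c * b i)"
  using \<open>k \<le> n\<close>
proof (induction k)
  case 0
  show ?case using nonderogatory_eigenspace[OF A nd, of l] unfolding atLeast0LessThan Ball_def lessThan_iff .
next
  case (Suc k)
  then have k: "k < n" by simp
  have low: "A $$ (i, k) = 0" if "i \<in> {Suc k..<n}" for i
    using ut A that by (auto simp: upper_triangular_def)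
  define top where "top v = (\<Sum>j\<in>{Suc k..<n}. A $$ (k, j) * v j)" for v
  let ?ev = "\<lambda>k v. \<forall>i\<in>{k..<n}. (\<Sum>j\<in>{k..<n}. A $$ (i, j) * v j) = l * v i"
  obtain b where b: "\<And>v. ?ev k v \<Longrightarrow> \<exists>c. \<forall>i\<in>{k..<n}. v i = c * b i"
    using Suc by auto
  have interval: "{k..<n} = insert k {Suc k..<n}" using k by auto
  have lift: "?ev k (v(k := x))" if "?ev (Suc k) v" "A $$ (k, k) * x + top v = l * x" for v x
  proof
    fix i assume i: "i \<in> {k..<n}"
    have "(\<Sum>j\<in>{k..<n}. A $$ (i, j) * (v(k := x)) j)
        = A $$ (i, k) * x + (\<Sum>j\<in>{Suc k..<n}. A $$ (i, j) * v j)"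
      by (simp add: interval)
    then show "(\<Sum>j\<in>{k..<n}. A $$ (i, j) * (v(k := x)) j) = l * (v(k := x)) i"
      using that i low[of i] by (cases "i = k") (auto simp: top_def)
  qed
  show ?case
  proof (cases "A $$ (k, k) = l")
    case False
    have "\<exists>c. \<forall>i\<in>{Suc k..<n}. v i = c * b i" if v: "?ev (Suc k) v" for v
    proof -
      \<comment> \<open>Row \<open>k\<close> can be solved for the new entry, so every solution
        lifts.\<close>
      have "A $$ (k, k) * (top v / (l - A $$ (k, k))) + top v = l * (top v / (l - A $$ (k, k)))"
        using False by (simp add: divide_simps) (simp add: algebra_simps)
      from b[OF lift[OF v this]] obtain c
        where "\<forall>i\<in>{k..<n}. (v(k := top v / (l - A $$ (k, k)))) i = c * b i" by blast
      then have "\<forall>i\<in>{Suc k..<n}. v i = c * b i" by (auto simp: interval)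
      then show ?thesis by blast
    qed
    then show ?thesis by blast
  next
    case True
    \<comment> \<open>The basis vector of index k is an eigenvector, so one that lifts with entry 0 at k vanishes.\<close>
    have e: "?ev k ((\<lambda>_. 0)(k := 1))"
      by (rule lift) (simp_all add: True top_def)
    have b0: "b i = 0" if "i \<in> {Suc k..<n}" for i
    proof -
      obtain c where c: "\<forall>i\<in>{k..<n}. ((\<lambda>_. 0)(k := 1)) i = c * b i" using b[OF e] by blast
      then have "c * b k = 1" "c * b i = 0" using that k by (auto simp: interval)
      then show ?thesis by auto
    qed
    have zero: "v i = 0" if "?ev (Suc k) v" "top v = 0" "i \<in> {Suc k..<n}" for v i
    proof -
      have "?ev k (v(k := 0))" using that by (intro lift) auto
      from b[OF this] obtain c where "\<forall>i\<in>{k..<n}. (v(k := 0)) i = c * b i" by blast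
      then show ?thesis using that(3) b0 by (auto simp: interval)
    qed
    show ?thesis
    \<comment> \<open>By \<open>zero\<close>, the linear functional \<open>top\<close> is injective
      on the solutions for the smaller block. Hence they form at most a line, spanned by any
      \<open>u\<close> with \<open>top u\<close> nonzero.\<close>
    proof (cases "\<exists>u. ?ev (Suc k) u \<and> top u \<noteq> 0")
      case True
      then obtain u where u: "?ev (Suc k) u" "top u \<noteq> 0" by blast
      have "\<exists>c. \<forall>i\<in>{Suc k..<n}. v i = c * u i" if v: "?ev (Suc k) v" for v
      proof -
        define w where "w i = v i - top v / top u * u i" for i
        have sum_w: "(\<Sum>j\<in>{Suc k..<n}. f j * w j)
            = (\<Sum>j\<in>{Suc k..<n}. f j * v j) - top v / top u * (\<Sum>j\<in>{Suc k..<n}. f j * u j)" for f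
          by (simp add: w_def algebra_simps sum_subtractf sum_distrib_left)
        have "?ev (Suc k) w" using u(1) v unfolding sum_w by (auto simp: w_def algebra_simps)
        moreover have "top w = 0" using u(2) unfolding top_def[of w] sum_w by (simp add: top_def)
        ultimately have "w i = 0" if "i \<in> {Suc k..<n}" for i using zero that by blast
        then show ?thesis by (intro exI[of _ "top v / top u"]) (simp add: w_def)
      qed
      then show ?thesis by blast
    next
      case False
      \<comment> \<open>The product has the shape \<open>c * b i\<close>, with both factors
        zero.\<close>
      have "\<forall>i\<in>{Suc k..<n}. v i = 0 * 0" if "?ev (Suc k) v" for v
        using zero[OF that] False that by auto
      then show ?thesis by (intro exI[of _ "\<lambda>_. 0"]) blast
    qed
  qed
qed

section \<open>Unit rows and columns, and diagonality of unitary intertwiners\<close>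

lemma mat_adjoint_index:
  assumes "A \<in> carrier_mat n n" "i < n" "j < n"
  shows "mat_adjoint A $$ (i, j) = cnj (A $$ (j, i))"
  using assms by (simp add: mat_adjoint_def mat_of_rows_index)

lemma mat_adjoint_carrier [simp]:
  "A \<in> carrier_mat n n \<Longrightarrow> mat_adjoint A \<in> carrier_mat n n"
  unfolding mat_adjoint_def by (rule carrier_matI) (simp_all add: mat_of_rows_def)

lemma times_mat_index_sum:
  assumes "A \<in> carrier_mat n n" "B \<in> carrier_mat n n" "i < n" "j < n"
  shows "(A * B) $$ (i, j) = (\<Sum>k<n. A $$ (i, k) * B $$ (k, j))"
  using assms by (simp add: scalar_prod_def atLeast0LessThan)

lemma unitary_mat_col_norm:
  assumes "unitary_mat n U" "j < n"
  shows "(\<Sum>i<n. (cmod (U $$ (i, j)))\<^sup>2) = 1"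
proof -
  have U: "U \<in> carrier_mat n n" "mat_adjoint U * U = 1\<^sub>m n"
    using assms by (auto simp: unitary_mat_def)
  have "(mat_adjoint U * U) $$ (j, j) = of_real (\<Sum>i<n. (cmod (U $$ (i, j)))\<^sup>2)"
    using U(1) assms(2)
    by (simp add: times_mat_index_sum[of _ n] mat_adjoint_index[of _ n] complex_norm_square
        mult.commute[of "cnj _"] del: index_mult_mat of_real_power)
  then show ?thesis using U(2) assms(2) by (metis index_one_mat(1) of_real_eq_1_iff)
qed

lemma unitary_mat_row_norm:
  assumes "unitary_mat n U" "i < n"
  shows "(\<Sum>j<n. (cmod (U $$ (i, j)))\<^sup>2) = 1"
proof -
  have U: "U \<in> carrier_mat n n" "U * mat_adjoint U = 1\<^sub>m n"
    using assms by (auto simp: unitary_mat_def)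
  have "(U * mat_adjoint U) $$ (i, i) = of_real (\<Sum>j<n. (cmod (U $$ (i, j)))\<^sup>2)"
    using U(1) assms(2)
    by (simp add: times_mat_index_sum[of _ n] mat_adjoint_index[of _ n] complex_norm_square
        del: index_mult_mat of_real_power)
  then show ?thesis using U(2) assms(2) by (metis index_one_mat(1) of_real_eq_1_iff)
qed

text \<open>Rows and columns are cleared together: the cleared rows confine column \<open>k\<close>
  to the trailing block, and the cleared columns reduce column \<open>k\<close> of
  \<open>U * A\<close> to a single term.\<close>

lemma unitary_intertwiner_diagonal:
  fixes A B U :: "complex mat"
  assumes A: "A \<in> carrier_mat n n" and B: "B \<in> carrier_mat n n"
    and utA: "upper_triangular A" and utB: "upper_triangular B" and nd: "nonderogatory B"
    and diag: "\<And>i. i < n \<Longrightarrow> A $$ (i, i) = B $$ (i, i)"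
    and U: "unitary_mat n U" and comm: "B * U = U * A"
    and ij: "i < n" "j < n" "i \<noteq> j"
  shows "U $$ (i, j) = 0"
proof -
  have Uc: "U \<in> carrier_mat n n" using U by (simp add: unitary_mat_def)
  have "k \<le> n \<Longrightarrow> \<forall>j<k. \<forall>i<n. i \<noteq> j \<longrightarrow> U $$ (i, j) = 0 \<and> U $$ (j, i) = 0" for k
  proof (induction k)
    case (Suc k)
    then have k: "k < n" and IH: "\<And>i j. \<lbrakk>j < k; i < n; i \<noteq> j\<rbrakk> \<Longrightarrow> U $$ (i, j) = 0 \<and> U $$ (j, i) = 0"
      by auto
    obtain b where b: "\<And>v. (\<forall>i\<in>{k..<n}. (\<Sum>j\<in>{k..<n}. B $$ (i, j) * v j) = B $$ (k, k) * v i)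
        \<Longrightarrow> \<exists>c. \<forall>i\<in>{k..<n}. v i = c * b i"
      using trailing_eigenspace[OF B utB nd, of k "B $$ (k, k)"] k by auto
    \<comment> \<open>The basis vector of index \<open>k\<close> is an eigenvector of the trailing
      block, so \<open>b\<close> is a multiple of it.\<close>
    have "(\<Sum>j\<in>{k..<n}. B $$ (i, j) * of_bool (j = k)) = B $$ (k, k) * of_bool (i = k)"
      if "i \<in> {k..<n}" for i
      using that utB B by (auto simp: upper_triangular_def of_bool_def if_distrib cong: if_cong)
    then obtain c where c: "\<forall>i\<in>{k..<n}. of_bool (i = k) = c * b i"
      using b[of "\<lambda>i. of_bool (i = k)"] by blast
    have b0: "b i = 0" if "i \<in> {k..<n}" "i \<noteq> k" for i
    proof -
      have "c * b k = 1" "c * b i = 0" using c[rule_format, of k] c[rule_format, of i] that k by auto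
      then show ?thesis by auto
    qed
    have "(\<Sum>j\<in>{k..<n}. B $$ (i, j) * U $$ (j, k)) = B $$ (k, k) * U $$ (i, k)"
      if i: "i \<in> {k..<n}" for i
    proof -
      have "(\<Sum>j\<in>{k..<n}. B $$ (i, j) * U $$ (j, k)) = (\<Sum>j<n. B $$ (i, j) * U $$ (j, k))"
        using IH k by (intro sum.mono_neutral_left) auto
      also have "\<dots> = (U * A) $$ (i, k)"
        using i k B Uc by (simp add: times_mat_index_sum[of _ n] del: index_mult_mat flip: comm)
      also have "\<dots> = (\<Sum>j<n. U $$ (i, j) * A $$ (j, k))"
        using i k A Uc by (simp add: times_mat_index_sum[of _ n] del: index_mult_mat)
      \<comment> \<open>Terms with \<open>j < k\<close> vanish by the induction hypothesis, those
        with \<open>j > k\<close> because \<open>A\<close> is triangular.\<close>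
      also have "\<dots> = (\<Sum>j\<in>{k}. U $$ (i, j) * A $$ (j, k))"
        using i k IH utA A
        by (intro sum.mono_neutral_right) (auto simp: upper_triangular_def linorder_neq_iff)
      finally show ?thesis using diag[OF k] by simp
    qed
    then obtain a where a: "\<forall>i\<in>{k..<n}. U $$ (i, k) = a * b i"
      using b[of "\<lambda>i. U $$ (i, k)"] by blast
    have col: "U $$ (i, k) = 0" if "i < n" "i \<noteq> k" for i
      using IH[of i k] a b0 that k by (cases "i < k") auto
    \<comment> \<open>The unit column forces modulus 1 at the diagonal, which leaves nothing for the
      rest of the unit row.\<close>
    have "(\<Sum>i<n. (cmod (U $$ (i, k)))\<^sup>2) = (\<Sum>i\<in>{k}. (cmod (U $$ (i, k)))\<^sup>2)"
      using k col by (intro sum.mono_neutral_right) auto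
    then have kk: "(cmod (U $$ (k, k)))\<^sup>2 = 1" using unitary_mat_col_norm[OF U k] by simp
    have "(\<Sum>j\<in>{..<n} - {k}. (cmod (U $$ (k, j)))\<^sup>2) = 0"
      using unitary_mat_row_norm[OF U k] k kk by (subst (asm) sum.remove[of _ k]) auto
    then have "U $$ (k, i) = 0" if "i < n" "i \<noteq> k" for i
      using that by (subst (asm) sum_nonneg_eq_0_iff) auto
    then show ?case using IH col by (auto simp: less_Suc_eq)
  qed simp
  from this[of n] ij show ?thesis by blast
qed

section \<open>The normal form K\<close>

\<comment> \<open>The last diagonal phase of X is fixed at 0: the last node of the network is grounded.\<close>
definition potential :: "nat \<Rightarrow> real Matrix.vec \<Rightarrow> nat \<Rightarrow> real" where
  "potential n \<psi> i = (if i < n - 1 then \<psi> $ i else 0)"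

text \<open>\<open>R_mat\<close> is the weighted graph Laplacian without the row and column of the
  last node. Deleting the column amounts to potential 0 there.\<close>

lemma R_mat_mult_vec:
  assumes "\<psi> \<in> carrier_vec (n - 1)" "s < n - 1"
  shows "(R_mat n r *\<^sub>v \<psi>) $ s
    = net_flow n (\<lambda>i j. r i j * (potential n \<psi> i - potential n \<psi> j)) s"
proof -
  let ?p = "potential n \<psi>"
  define D where "D = (\<Sum>k<s. r k s) + (\<Sum>k\<in>{s<..<n}. r s k)"
  let ?R = "\<lambda>k. if s < k then - r s k else if s = k then D else - r k s"
  have "(R_mat n r *\<^sub>v \<psi>) $ s = (\<Sum>k<n - 1. ?R k * \<psi> $ k)"
    using assms
    by (auto simp: R_mat_def scalar_prod_def atLeast0LessThan D_def intro!: sum.cong)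
  also have "\<dots> = (\<Sum>k<n. ?R k * ?p k)"
    by (intro sum.mono_neutral_cong_left) (auto simp: potential_def)
  also have "{..<n} = {..<s} \<union> insert s {s<..<n}"
    using assms(2) by auto
  also have "(\<Sum>k\<in>{..<s} \<union> insert s {s<..<n}. ?R k * ?p k)
      = (\<Sum>k<s. ?R k * ?p k) + (D * ?p s + (\<Sum>k\<in>{s<..<n}. ?R k * ?p k))"
    by (subst sum.union_disjoint) auto
  also have "(\<Sum>k<s. ?R k * ?p k) = - (\<Sum>k<s. r k s * ?p k)"
    unfolding sum_negf[symmetric] by (intro sum.cong) auto
  also have "(\<Sum>k\<in>{s<..<n}. ?R k * ?p k) = - (\<Sum>k\<in>{s<..<n}. r s k * ?p k)"
    unfolding sum_negf[symmetric] by (intro sum.cong) auto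
  finally show ?thesis
    by (simp add: net_flow_def D_def right_diff_distrib sum_subtractf distrib_right
        sum_distrib_right del: One_nat_def)
qed

lemma b_vec_index:
  "s < n - 1 \<Longrightarrow> b_vec n r \<phi> $ s = net_flow n (\<lambda>i j. r i j * \<phi> i j) s"
  by (simp add: b_vec_def net_flow_def atLeast0LessThan)

\<comment> \<open>The vanishing of its net flow at node s is row s of the linear system defining K.\<close>
definition residual_flow ::
    "complex mat \<Rightarrow> (nat \<Rightarrow> nat \<Rightarrow> int) \<Rightarrow> (nat \<Rightarrow> real) \<Rightarrow> nat \<Rightarrow> nat \<Rightarrow> real" where
  "residual_flow \<Delta> m p i j =
     cmod (\<Delta> $$ (i, j)) * (p i - p j + (Arg2pi (\<Delta> $$ (i, j)) - pi + 2 * pi * real_of_int (m i j)))"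

lemma is_K_solution_iff:
  assumes "\<Delta> \<in> carrier_mat n n"
  shows "is_K_solution \<Delta> m \<psi> \<longleftrightarrow> \<psi> \<in> carrier_vec (n - 1) \<and>
    (\<forall>s<n - 1. net_flow n (residual_flow \<Delta> m (potential n \<psi>)) s = 0)"
proof (cases "\<psi> \<in> carrier_vec (n - 1)")
  case True
  define b where "b = b_vec n (mod_entries \<Delta>)
    (\<lambda>i j. arg_entries \<Delta> i j + 2 * pi * real_of_int (m i j))"
  have flow: "(R_mat n (mod_entries \<Delta>) *\<^sub>v \<psi>) $ s + b $ s
      = net_flow n (residual_flow \<Delta> m (potential n \<psi>)) s" if "s < n - 1" for s
    unfolding b_def R_mat_mult_vec[OF True that] b_vec_index[OF that] net_flow_add[symmetric]
    by (simp add: residual_flow_def[abs_def] mod_entries_def arg_entries_def algebra_simps)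
  have dim: "dim_row (R_mat n (mod_entries \<Delta>)) = n - 1" "dim_vec b = n - 1"
    by (simp_all add: b_def b_vec_def R_mat_def)
  have "R_mat n (mod_entries \<Delta>) *\<^sub>v \<psi> = - b \<longleftrightarrow>
      (\<forall>s<n - 1. (R_mat n (mod_entries \<Delta>) *\<^sub>v \<psi>) $ s + b $ s = 0)"
    by (simp add: Matrix.vec_eq_iff dim eq_neg_iff_add_eq_0 del: One_nat_def index_mult_mat_vec)
  then show ?thesis
    using True assms flow by (simp add: is_K_solution_def Let_def b_def)
qed (use assms in \<open>simp add: is_K_solution_def Let_def\<close>)

section \<open>Conjugation by diagonal unitary matrices and evaluation of K\<close>

lemma mat_adjoint_diag: "mat_adjoint (mat_diag n f) = mat_diag n (\<lambda>i. cnj (f i))"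
proof (rule eq_matI)
  fix i j assume "i < dim_row (mat_diag n (\<lambda>i. cnj (f i)))" "j < dim_col (mat_diag n (\<lambda>i. cnj (f i)))"
  then show "mat_adjoint (mat_diag n f) $$ (i, j) = mat_diag n (\<lambda>i. cnj (f i)) $$ (i, j)"
    by (subst mat_adjoint_index[of _ n]) (auto simp: mat_diag_def)
qed (auto simp: mat_adjoint_def mat_diag_def)

lemma mat_diag_conj:
  fixes A :: "complex mat"
  assumes A: "A \<in> carrier_mat n n"
  shows "mat_diag n f * A * mat_adjoint (mat_diag n f)
    = Matrix.mat n n (\<lambda>(i, j). f i * cnj (f j) * A $$ (i, j))"
  by (simp only: mat_adjoint_diag mat_diag_mult_left[OF A])
    (subst mat_diag_mult_right[of _ n], auto simp: ac_simps)

lemma unitary_mat_diag: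
  assumes "\<And>i. i < n \<Longrightarrow> cmod (f i) = 1"
  shows "unitary_mat n (mat_diag n f)"
proof -
  have "mat_diag n (\<lambda>i. f i * cnj (f i)) = 1\<^sub>m n"
    using assms by (intro eq_matI) (auto simp: mat_diag_def complex_norm_square[symmetric])
  then show ?thesis
    unfolding unitary_mat_def mat_adjoint_diag mat_diag_diag by (simp add: mult.commute)
qed

text \<open>Eliminates the choice by \<open>SOME\<close>: by uniqueness, any grounded solution gives
  the same phase differences wherever the entry of \<open>\<Delta>\<close> above the diagonal is
  nonzero.\<close>

lemma K_mat_eq:
  assumes \<Delta>: "\<Delta> \<in> carrier_mat n n" "upper_triangular \<Delta>"
    and p: "p (n - 1) = 0" "\<And>s. s < n - 1 \<Longrightarrow> net_flow n (residual_flow \<Delta> m p) s = 0"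
  shows "K_mat \<Delta> m = Matrix.mat n n (\<lambda>(i, j). cis (p i - p j) * \<Delta> $$ (i, j))"
proof -
  define \<psi> where "\<psi> = (SOME \<psi>. is_K_solution \<Delta> m \<psi>)"
  let ?q = "potential n \<psi>"
  \<comment> \<open>Truncating \<open>p\<close> to a vector and extending it by 0 restores
    \<open>p\<close> on all nodes, since \<open>p (n - 1) = 0\<close>.\<close>
  have "net_flow n (residual_flow \<Delta> m (potential n (Matrix.vec (n - 1) p))) s
      = net_flow n (residual_flow \<Delta> m p) s" if "s < n" for s
    using p(1) that
    by (intro net_flow_cong) (auto simp: residual_flow_def potential_def not_less le_antisym
        dest!: antisym_conv2 intro: arg_cong[where f = p])
  then have "is_K_solution \<Delta> m (Matrix.vec (n - 1) p)"
    using p(2) by (auto simp: is_K_solution_iff[OF \<Delta>(1)])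
  then have "is_K_solution \<Delta> m \<psi>" unfolding \<psi>_def by (rule someI)
  then have q: "net_flow n (residual_flow \<Delta> m ?q) s = 0" if "s < n - 1" for s
    using that by (simp add: is_K_solution_iff[OF \<Delta>(1)])
  have same: "?q i - ?q j = p i - p j" if "i < j" "j < n" "\<Delta> $$ (i, j) \<noteq> 0" for i j
    using p q that
    by (intro net_flow_unique[where r = "\<lambda>i j. cmod (\<Delta> $$ (i, j))" and n = n
          and \<phi> = "\<lambda>i j. Arg2pi (\<Delta> $$ (i, j)) - pi + 2 * pi * real_of_int (m i j)"])
      (auto simp: potential_def residual_flow_def[abs_def])
  have "X_mat n \<psi> = mat_diag n (\<lambda>i. cis (?q i))"
    by (intro eq_matI) (auto simp: X_mat_def mat_diag_def potential_def cis_conv_exp)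
  then have "K_mat \<Delta> m = Matrix.mat n n (\<lambda>(i, j). cis (?q i) * cnj (cis (?q j)) * \<Delta> $$ (i, j))"
    using \<Delta> mat_diag_conj[OF \<Delta>(1), of "\<lambda>i. cis (?q i)"]
    by (simp add: K_mat_def Let_def flip: \<psi>_def)
  also have "\<dots> = Matrix.mat n n (\<lambda>(i, j). cis (?q i - ?q j) * \<Delta> $$ (i, j))"
    by (simp add: cis_cnj cis_mult)
  also have "\<dots> = Matrix.mat n n (\<lambda>(i, j). cis (p i - p j) * \<Delta> $$ (i, j))"
  proof (rule cong_mat)
    fix i j assume ij: "i < n" "j < n"
    show "(case (i, j) of (i, j) \<Rightarrow> cis (?q i - ?q j) * \<Delta> $$ (i, j))
        = (case (i, j) of (i, j) \<Rightarrow> cis (p i - p j) * \<Delta> $$ (i, j))"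
    \<comment> \<open>A zero entry absorbs any phase, and on the diagonal the phases cancel.\<close>
    proof (cases "\<Delta> $$ (i, j) = 0 \<or> i = j")
      case False
      then have "i < j" using \<Delta> ij by (metis carrier_matD(1) linorder_neqE_nat upper_triangular_def)
      then show ?thesis using same[of i j] ij False by simp
    qed auto
  qed simp_all
  finally show ?thesis .
qed

lemma residual_flow_solvable:
  obtains p where "p (n - 1) = 0" "\<And>s. s < n - 1 \<Longrightarrow> net_flow n (residual_flow \<Delta> m p) s = 0"
  using net_flow_solvable[of "\<lambda>i j. cmod (\<Delta> $$ (i, j))" n
      "\<lambda>i j. Arg2pi (\<Delta> $$ (i, j)) - pi + 2 * pi * real_of_int (m i j)"]
  by (auto simp: residual_flow_def[abs_def])

text \<open>Multiplying the similarity by the unitary matrix on the right makes it an intertwiner,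
  hence diagonal; \<open>u\<close> is its diagonal.\<close>

lemma diagonal_phases:
  assumes B: "B \<in> carrier_mat n n" and A: "A \<in> carrier_mat n n"
    and utA: "upper_triangular A" and utB: "upper_triangular B" and nd: "nonderogatory B"
    and diag: "\<And>i. i < n \<Longrightarrow> A $$ (i, i) = B $$ (i, i)"
    and sim: "unitarily_similar A B"
  obtains u where "\<And>i. i < n \<Longrightarrow> cmod (u i) = 1"
    "\<And>i j. i < n \<Longrightarrow> j < n \<Longrightarrow> B $$ (i, j) = u i * cnj (u j) * A $$ (i, j)"
proof -
  obtain U where U: "unitary_mat n U" and eq: "B = U * A * mat_adjoint U"
    using sim A unfolding unitarily_similar_def by auto
  have Uc: "U \<in> carrier_mat n n" "mat_adjoint U * U = 1\<^sub>m n" using U by (auto simp: unitary_mat_def)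
  have "B * U = U * A * (mat_adjoint U * U)"
    unfolding eq using Uc(1) A by (intro assoc_mult_mat[of _ n n _ n _ n]) auto
  then have comm: "B * U = U * A" using Uc A by simp
  define u where "u i = U $$ (i, i)" for i
  have off: "U $$ (i, j) = 0" if "i < n" "j < n" "i \<noteq> j" for i j
    using unitary_intertwiner_diagonal[OF A B utA utB nd diag U comm that] .
  then have Ud: "U = mat_diag n u"
    using Uc(1) by (intro eq_matI) (auto simp: mat_diag_def u_def)
  have "cmod (u i) = 1" if "i < n" for i
  proof -
    have "(\<Sum>j<n. (cmod (U $$ (i, j)))\<^sup>2) = (\<Sum>j\<in>{i}. (cmod (U $$ (i, j)))\<^sup>2)"
      using off that by (intro sum.mono_neutral_right) auto
    then have "(cmod (u i))\<^sup>2 = 1"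
      using unitary_mat_row_norm[OF U that] by (simp add: u_def)
    then show ?thesis by (simp add: power2_eq_1_iff) (metis norm_ge_zero neg_0_le_iff_le not_one_le_zero)
  qed
  moreover have "B $$ (i, j) = u i * cnj (u j) * A $$ (i, j)" if "i < n" "j < n" for i j
    using that unfolding eq Ud mat_diag_conj[OF A] by simp
  ultimately show ?thesis using that by blast
qed

section \<open>Arguments, phases and winding numbers\<close>

lemma unit_phase_Arg2pi:
  assumes "cmod u = 1" "z \<noteq> 0"
  shows "cis (Arg2pi (u * z) - Arg2pi z) = u"
proof -
  have "cis (Arg2pi w) = w / cmod w" if "w \<noteq> 0" for w
    using that Arg2pi_eq[of w] by (simp add: cis_conv_exp field_simps)
  moreover have "u \<noteq> 0" using assms(1) by auto
  ultimately have "cis (Arg2pi (u * z)) = u * z / cmod z" "cis (Arg2pi z) = z / cmod z"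
    using assms by (auto simp: norm_mult)
  then show ?thesis
    using assms by (simp flip: cis_divide)
qed

lemma abs_Arg2pi_diff: "\<bar>Arg2pi z - Arg2pi w\<bar> < 2 * pi"
  using Arg2pi_ge_0[of z] Arg2pi_ge_0[of w] Arg2pi_lt_2pi[of z] Arg2pi_lt_2pi[of w] by linarith

lemma cis_eq_1_imp: "cis x = 1 \<Longrightarrow> \<exists>k::int. x = 2 * pi * of_int k"
  using exp_eq_1[of "\<i> * complex_of_real x"] by (auto simp: cis_conv_exp mult_ac)

text \<open>Only quotients of the \<open>u i\<close> matter, so the last phase can be normalized to
  1. Where the last column is nonzero, \<open>\<theta> i\<close> is the exact difference of
  arguments, which makes the winding number 0 there, as \<open>I_set\<close> demands. Where it is
  zero, a representative in \<open>[0, 2 pi)\<close> keeps the bound.\<close>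

lemma normalized_phases:
  fixes A :: "complex mat"
  assumes n: "n \<ge> 1" and u: "\<And>i. i < n \<Longrightarrow> cmod (u i) = 1"
    and B: "\<And>i. i < n \<Longrightarrow> B $$ (i, n - 1) = u i * cnj (u (n - 1)) * A $$ (i, n - 1)"
  obtains \<theta> :: "nat \<Rightarrow> real" where "\<theta> (n - 1) = 0"
    "\<And>i. i < n \<Longrightarrow> \<bar>\<theta> i\<bar> < 2 * pi"
    "\<And>i. i < n \<Longrightarrow> cis (\<theta> i) = u i * cnj (u (n - 1))"
    "\<And>i. i < n - 1 \<Longrightarrow> A $$ (i, n - 1) \<noteq> 0
      \<Longrightarrow> \<theta> i = Arg2pi (B $$ (i, n - 1)) - Arg2pi (A $$ (i, n - 1))"
proof -
  define \<theta> where "\<theta> i = (if i = n - 1 then 0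
    else if A $$ (i, n - 1) = 0 then Arg2pi (u i * cnj (u (n - 1)))
    else Arg2pi (B $$ (i, n - 1)) - Arg2pi (A $$ (i, n - 1)))" for i
  have w: "cmod (u i * cnj (u (n - 1))) = 1" if "i < n" for i
    using u n that by (simp add: norm_mult)
  have "\<theta> (n - 1) = 0" by (simp add: \<theta>_def)
  moreover have "\<bar>\<theta> i\<bar> < 2 * pi" for i
    using abs_Arg2pi_diff Arg2pi_ge_0 Arg2pi_lt_2pi by (auto simp: \<theta>_def abs_of_nonneg)
  moreover have "cis (\<theta> i) = u i * cnj (u (n - 1))" if i: "i < n" for i
  proof -
    have "u (n - 1) * cnj (u (n - 1)) = 1"
      using u[of "n - 1"] n by (simp flip: complex_norm_square)
    \<comment> \<open>Taking \<open>z = 1\<close>, of argument 0, turns the difference of arguments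
      into a single one.\<close>
    moreover have "cis (Arg2pi (u i * cnj (u (n - 1)))) = u i * cnj (u (n - 1))"
      using unit_phase_Arg2pi[OF w[OF i], of 1] Arg2pi_of_real[of 1] by simp
    ultimately show ?thesis
      using unit_phase_Arg2pi[OF w[OF i], of "A $$ (i, n - 1)"] B[OF i] by (simp add: \<theta>_def)
  qed
  moreover have "\<theta> i = Arg2pi (B $$ (i, n - 1)) - Arg2pi (A $$ (i, n - 1))"
    if "i < n - 1" "A $$ (i, n - 1) \<noteq> 0" for i
    using that by (simp add: \<theta>_def)
  ultimately show ?thesis using that[of \<theta>] by blast
qed

text \<open>An integer \<open>m\<close> with absolute value at most 2 equals
  \<open>sgn m - (sgn m - m)\<close>, and both terms lie in \<open>{0, 1, -1}\<close>.\<close>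

lemma I_set_splits_winding:
  fixes N :: "nat \<Rightarrow> nat \<Rightarrow> int"
  assumes "\<And>i j. i < j \<Longrightarrow> j < n - 1 \<Longrightarrow> \<bar>N i j\<bar> \<le> 2" and "\<And>i. i < n - 1 \<Longrightarrow> N i (n - 1) = 0"
  obtains k l where "k \<in> I_set n" "l \<in> I_set n" "\<And>i j. k i j - l i j = N i j"
proof
  show "(\<lambda>i j. sgn (N i j)) \<in> I_set n"
    using assms(2) by (auto simp: I_set_def sgn_if)
  have "sgn m - m \<in> {0, 1, -1}" if "\<bar>m\<bar> \<le> 2" for m :: int
    using that by (auto simp: sgn_if)
  then show "(\<lambda>i j. sgn (N i j) - N i j) \<in> I_set n"
    using assms by (fastforce simp: I_set_def)
qed simp

theorem theorem3p1:
  fixes n :: nat and \<Delta>1 \<Delta>2 :: "complex mat"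
  assumes "n \<ge> 1"
    and "\<Delta>1 \<in> carrier_mat n n" and "\<Delta>2 \<in> carrier_mat n n"
    and "upper_triangular \<Delta>1" and "upper_triangular \<Delta>2"
    and "nonderogatory \<Delta>1" and "nonderogatory \<Delta>2"
    and "\<And>i. i < n \<Longrightarrow> \<Delta>1 $$ (i, i) = \<Delta>2 $$ (i, i)"
  shows "unitarily_similar \<Delta>1 \<Delta>2 \<longleftrightarrow>
    (\<exists>k1 \<in> I_set n. \<exists>k2 \<in> I_set n. K_mat \<Delta>1 k1 = K_mat \<Delta>2 k2)"
proof
  note n = assms(1) and c1 = assms(2) and c2 = assms(3) and ut1 = assms(4) and ut2 = assms(5)
  {
    assume "\<exists>k1 \<in> I_set n. \<exists>k2 \<in> I_set n. K_mat \<Delta>1 k1 = K_mat \<Delta>2 k2"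
    then obtain k1 k2 where K: "K_mat \<Delta>1 k1 = K_mat \<Delta>2 k2" by blast
    obtain p where p: "p (n - 1) = 0" "\<And>s. s < n - 1 \<Longrightarrow> net_flow n (residual_flow \<Delta>1 k1 p) s = 0"
      using residual_flow_solvable[of n \<Delta>1 k1] by blast
    obtain q where q: "q (n - 1) = 0" "\<And>s. s < n - 1 \<Longrightarrow> net_flow n (residual_flow \<Delta>2 k2 q) s = 0"
      using residual_flow_solvable[of n \<Delta>2 k2] by blast
    have K1: "K_mat \<Delta>1 k1 = Matrix.mat n n (\<lambda>(i, j). cis (p i - p j) * \<Delta>1 $$ (i, j))"
      using p by (intro K_mat_eq[OF c1 ut1]) auto
    have K2: "K_mat \<Delta>2 k2 = Matrix.mat n n (\<lambda>(i, j). cis (q i - q j) * \<Delta>2 $$ (i, j))"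
      using q by (intro K_mat_eq[OF c2 ut2]) auto
    \<comment> \<open>Each K is a conjugate of its matrix by a diagonal unitary matrix;
      \<open>f\<close> is the quotient of the two diagonals.\<close>
    define f where "f i = cis (p i - q i)" for i
    have "\<Delta>2 = Matrix.mat n n (\<lambda>(i, j). f i * cnj (f j) * \<Delta>1 $$ (i, j))"
    proof (rule eq_matI)
      fix i j assume "i < dim_row (Matrix.mat n n (\<lambda>(i, j). f i * cnj (f j) * \<Delta>1 $$ (i, j)))"
        "j < dim_col (Matrix.mat n n (\<lambda>(i, j). f i * cnj (f j) * \<Delta>1 $$ (i, j)))"
      then have ij: "i < n" "j < n" by simp_all
      have "cis (p i - p j) * \<Delta>1 $$ (i, j) = cis (q i - q j) * \<Delta>2 $$ (i, j)"
        using arg_cong[OF K, of "\<lambda>M. M $$ (i, j)"] ij by (simp add: K1 K2)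
      then have "cis (q j - q i) * cis (q i - q j) * \<Delta>2 $$ (i, j)
          = cis (q j - q i) * cis (p i - p j) * \<Delta>1 $$ (i, j)"
        by (simp add: mult.assoc)
      then have "\<Delta>2 $$ (i, j) = f i * cnj (f j) * \<Delta>1 $$ (i, j)"
        by (simp add: cis_mult f_def cis_cnj algebra_simps)
      then show "\<Delta>2 $$ (i, j) = Matrix.mat n n (\<lambda>(i, j). f i * cnj (f j) * \<Delta>1 $$ (i, j)) $$ (i, j)"
        using ij by simp
    qed (use c2 in auto)
    moreover have "unitary_mat n (mat_diag n f)" by (rule unitary_mat_diag) (simp add: f_def)
    ultimately show "unitarily_similar \<Delta>1 \<Delta>2"
      unfolding unitarily_similar_def using c1 c2 mat_diag_conj[OF c1, of f] by metis
  }
  assume sim: "unitarily_similar \<Delta>1 \<Delta>2"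
  obtain u where u: "\<And>i. i < n \<Longrightarrow> cmod (u i) = 1"
    and \<Delta>2: "\<And>i j. i < n \<Longrightarrow> j < n \<Longrightarrow> \<Delta>2 $$ (i, j) = u i * cnj (u j) * \<Delta>1 $$ (i, j)"
    using diagonal_phases[OF c2 c1 ut1 ut2 assms(7,8) sim] by blast
  have last: "\<Delta>2 $$ (i, n - 1) = u i * cnj (u (n - 1)) * \<Delta>1 $$ (i, n - 1)" if "i < n" for i
    using \<Delta>2[OF that, of "n - 1"] n by simp
  obtain \<theta> :: "nat \<Rightarrow> real" where \<theta>0: "\<theta> (n - 1) = 0"
    and \<theta>_less: "\<And>i. i < n \<Longrightarrow> \<bar>\<theta> i\<bar> < 2 * pi"
    and \<theta>_cis: "\<And>i. i < n \<Longrightarrow> cis (\<theta> i) = u i * cnj (u (n - 1))"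
    and \<theta>_last: "\<And>i. i < n - 1 \<Longrightarrow> \<Delta>1 $$ (i, n - 1) \<noteq> 0
      \<Longrightarrow> \<theta> i = Arg2pi (\<Delta>2 $$ (i, n - 1)) - Arg2pi (\<Delta>1 $$ (i, n - 1))"
    by (rule normalized_phases[where A = \<Delta>1 and B = \<Delta>2 and u = u, OF n]) (use u last in blast)+
  have norm2: "cmod (\<Delta>2 $$ (i, j)) = cmod (\<Delta>1 $$ (i, j))" if "i < n" "j < n" for i j
    using that u by (simp add: \<Delta>2 norm_mult)
  have rot: "cis (\<theta> i - \<theta> j) = u i * cnj (u j)" if "i < n" "j < n" for i j
  proof -
    have "cis (\<theta> i - \<theta> j) = cis (\<theta> i) * cnj (cis (\<theta> j))" by (simp add: cis_cnj cis_mult)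
    also have "\<dots> = u i * cnj (u j) * (u (n - 1) * cnj (u (n - 1)))"
      using that by (simp add: \<theta>_cis ac_simps)
    also have "u (n - 1) * cnj (u (n - 1)) = 1"
      using u[of "n - 1"] n by (simp flip: complex_norm_square)
    finally show ?thesis by simp
  qed
  \<comment> \<open>The arguments of corresponding nonzero entries differ by
    \<open>\<theta> i - \<theta> j\<close> only up to full turns; \<open>gap\<close> is this
    excess.\<close>
  define gap where "gap i j = Arg2pi (\<Delta>2 $$ (i, j)) - Arg2pi (\<Delta>1 $$ (i, j)) - (\<theta> i - \<theta> j)" for i j
  have "\<exists>N::int. gap i j = 2 * pi * of_int N"
    if "i < n" "j < n" "\<Delta>1 $$ (i, j) \<noteq> 0" for i j
  proof (rule cis_eq_1_imp)
    have "cmod (u i * cnj (u j)) = 1" using u that by (simp add: norm_mult)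
    then have "cis (Arg2pi (\<Delta>2 $$ (i, j)) - Arg2pi (\<Delta>1 $$ (i, j))) = cis (\<theta> i - \<theta> j)"
      using unit_phase_Arg2pi that by (simp add: \<Delta>2 rot)
    then show "cis (gap i j) = 1" unfolding gap_def by (subst cis_divide[symmetric]) simp
  qed
  then have "\<forall>i j. \<exists>N::int. i < n \<longrightarrow> j < n \<longrightarrow> \<Delta>1 $$ (i, j) \<noteq> 0 \<longrightarrow> gap i j = 2 * pi * of_int N"
    by blast
  then obtain M :: "nat \<Rightarrow> nat \<Rightarrow> int" where
    M: "\<And>i j. i < n \<Longrightarrow> j < n \<Longrightarrow> \<Delta>1 $$ (i, j) \<noteq> 0 \<Longrightarrow> gap i j = 2 * pi * of_int (M i j)"
    by metis
  \<comment> \<open>At zero entries \<open>M\<close> is unspecified; the value 0 secures the bound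
    and the last-column condition there.\<close>
  define N where "N i j = (if \<Delta>1 $$ (i, j) = 0 then 0 else M i j)" for i j
  have "\<bar>N i j\<bar> \<le> 2" if "i < j" "j < n - 1" for i j
  proof (cases "\<Delta>1 $$ (i, j) = 0")
    case False
    \<comment> \<open>The gap is a sum of three quantities smaller than one full turn.\<close>
    have "\<bar>gap i j\<bar> < 3 * (2 * pi)"
      using abs_Arg2pi_diff[of "\<Delta>2 $$ (i, j)" "\<Delta>1 $$ (i, j)"] \<theta>_less[of i] \<theta>_less[of j] that
      unfolding gap_def by linarith
    then have "2 * pi * \<bar>real_of_int (M i j)\<bar> < 2 * pi * 3"
      using M[OF _ _ False] that by (simp add: abs_mult)
    then have "\<bar>M i j\<bar> < 3" by simp
    then show ?thesis by (simp add: N_def)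
  qed (simp add: N_def)
  moreover have "N i (n - 1) = 0" if "i < n - 1" for i
    using M[of i "n - 1"] that \<theta>_last[OF that] \<theta>0 by (auto simp: N_def gap_def)
  ultimately obtain k1 k2 where k: "k1 \<in> I_set n" "k2 \<in> I_set n" "\<And>i j. k1 i j - k2 i j = N i j"
    using I_set_splits_winding[of n N] by blast
  obtain q where q: "q (n - 1) = 0" "\<And>s. s < n - 1 \<Longrightarrow> net_flow n (residual_flow \<Delta>2 k2 q) s = 0"
    using residual_flow_solvable[of n \<Delta>2 k2] by blast
  \<comment> \<open>With this shift, \<open>k1 - k2 = N\<close> compensates the excess turns, so
    both residual flows agree edge by edge and \<open>p\<close> solves the system for
    \<open>\<Delta>1\<close>.\<close>
  define p where "p i = q i + \<theta> i" for i
  have "residual_flow \<Delta>1 k1 p i j = residual_flow \<Delta>2 k2 q i j" if "i < j" "j < n" for i j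
  proof (cases "\<Delta>1 $$ (i, j) = 0")
    case True
    then show ?thesis using norm2[of i j] that by (simp add: residual_flow_def)
  next
    case False
    have "gap i j = 2 * pi * (real_of_int (k1 i j) - real_of_int (k2 i j))"
      using M[OF _ _ False] that False k(3)[of i j] by (simp add: N_def flip: of_int_diff)
    then have "p i - p j + (Arg2pi (\<Delta>1 $$ (i, j)) - pi + 2 * pi * real_of_int (k1 i j))
        = q i - q j + (Arg2pi (\<Delta>2 $$ (i, j)) - pi + 2 * pi * real_of_int (k2 i j))"
      unfolding gap_def p_def by (simp add: algebra_simps)
    then show ?thesis using norm2[of i j] that by (simp add: residual_flow_def)
  qed
  then have p: "p (n - 1) = 0" "\<And>s. s < n - 1 \<Longrightarrow> net_flow n (residual_flow \<Delta>1 k1 p) s = 0"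
    using q \<theta>0 net_flow_cong[of n "residual_flow \<Delta>1 k1 p" "residual_flow \<Delta>2 k2 q"]
    by (simp_all add: p_def)
  have "cis (p i - p j) * \<Delta>1 $$ (i, j) = cis (q i - q j) * \<Delta>2 $$ (i, j)" if "i < n" "j < n" for i j
  proof -
    have "cis (p i - p j) = cis (q i - q j) * cis (\<theta> i - \<theta> j)"
      by (simp add: cis_mult p_def algebra_simps)
    then show ?thesis using that by (simp add: rot \<Delta>2)
  qed
  then have "Matrix.mat n n (\<lambda>(i, j). cis (p i - p j) * \<Delta>1 $$ (i, j))
      = Matrix.mat n n (\<lambda>(i, j). cis (q i - q j) * \<Delta>2 $$ (i, j))"
    by (intro cong_mat) auto
  moreover have "K_mat \<Delta>1 k1 = Matrix.mat n n (\<lambda>(i, j). cis (p i - p j) * \<Delta>1 $$ (i, j))"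
    using p by (intro K_mat_eq[OF c1 ut1]) auto
  moreover have "K_mat \<Delta>2 k2 = Matrix.mat n n (\<lambda>(i, j). cis (q i - q j) * \<Delta>2 $$ (i, j))"
    using q by (intro K_mat_eq[OF c2 ut2]) auto
  ultimately have "K_mat \<Delta>1 k1 = K_mat \<Delta>2 k2" by simp
  then show "\<exists>k1 \<in> I_set n. \<exists>k2 \<in> I_set n. K_mat \<Delta>1 k1 = K_mat \<Delta>2 k2" using k by blast
qed

end
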